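(* Let $n\ge m\ge 1$ be integers and let $\varphi(n,m)$ be the number of optimal solutions of the shifting-checkers game with $n$ black and $m$ white checkers, i.e. the number of distinct shortest paths from the initial configuration to the final configuration in the state space graph of the game. Then $$\varphi(n,m)=\begin{cases}\frac{1}{\sqrt5}\left(\left(\frac{1+\sqrt5}{2}\right)^{n+2}-\left(\frac{1-\sqrt5}{2}\right)^{n+2}\right)=F_{n+2} & n\ge m=1,\\ 2 & n\ge m>1,\end{cases}$$ where $F_k$ denotes the $k$-th Fibonacci number ($F_1=F_2=1$).
   Context: The game: positions $1,\dots,n+m+1$ in a row, each holding a black checker ($b$), a white checker ($w$) or nothing, with exactly one empty position (the vacancy $O$). Initial configuration $b^nOw^m$, final configuration $w^mOb^n$. A legal move is a slide (a checker adjacent to the vacancy moves into it) or a jump (a checker at distance two from the vacancy jumps over the checker between them into it), in either direction. The state space graph has the configurations as vertices, with an edge from one configuration to another if a single legal move transforms the first into the second. An optimal solution is a shortest path from the initial to the final configuration in this graph (its length is $nm+n+m$). *)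

theory Defs
  imports Complex_Main "HOL-Number_Theory.Fib"
begin

datatype cell = Bk | Wh | Vac

definition init_conf :: "nat \<Rightarrow> nat \<Rightarrow> cell list" where
  "init_conf n m = replicate n Bk @ [Vac] @ replicate m Wh"

definition final_conf :: "nat \<Rightarrow> nat \<Rightarrow> cell list" where
  "final_conf n m = replicate m Wh @ [Vac] @ replicate n Bk"

definition states :: "nat \<Rightarrow> nat \<Rightarrow> cell list set" where
  "states n m = {c. length c = n + m + 1 \<and> count_list c Bk = n \<and> count_list c Wh = m
                     \<and> count_list c Vac = 1}"

definition move :: "cell list \<Rightarrow> cell list \<Rightarrow> bool" where
  "move c c' \<longleftrightarrow> (\<exists>i j. i < length c \<and> j < length c \<and> c ! i = Vac \<and> c ! j \<noteq> Vac \<and>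
      (j = i + 1 \<or> i = j + 1 \<or>
       ((j = i + 2 \<or> i = j + 2) \<and> c ! ((i + j) div 2) \<noteq> Vac)) \<and>
      c' = c[i := c ! j, j := Vac])"

definition paths :: "nat \<Rightarrow> nat \<Rightarrow> nat \<Rightarrow> cell list list set" where
  "paths n m k = {ps. length ps = Suc k \<and> hd ps = init_conf n m \<and> last ps = final_conf n m \<and>
                      set ps \<subseteq> states n m \<and> (\<forall>i<k. move (ps ! i) (ps ! Suc i))}"

definition opt_len :: "nat \<Rightarrow> nat \<Rightarrow> nat" where
  "opt_len n m = (LEAST k. paths n m k \<noteq> {})"

definition num_opt :: "nat \<Rightarrow> nat \<Rightarrow> nat" where
  "num_opt n m = card (paths n m (opt_len n m))"

end

theory Submission
  imports Defs "HOL-Library.Multiset"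
begin

text \<open>
  Delete the vacancy from a configuration and remember its position as a gap in a word over
  b, w. A slide moves the gap by one and keeps the word; a jump moves the gap by two and swaps the
  two letters it passes. The word b^n w^m has to become w^m b^n, so the swaps of adjacent pairs bw
  needed are indexed by the cells of an n by m rectangle and fill it up like a standard
  Young tableau. A swap requires a gap of the parity of its position, which alternates along
  every maximal chain of cells; hence, along each chain, at least n + m slides are needed besides
  the n m swaps. This gives a potential that drops by at most one per move, for each chain.

  The two chains along the border of the rectangle already determine the shortest solutions.
  In such a solution every move lowers both potentials, so the antidiagonals of the rectangle are
  completed one after the other, with exactly one slide in between. The swaps of one antidiagonal
  are neighbours at distance two, so the gap has to sweep over them from one end to the other. If
  n, m > 1, the slide leading to the next sweep is forced, except for the very first one. If
  m = 1, an antidiagonal is a single cell and can be entered from both sides after a sweep to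
  the left, but only from one side after a sweep to the right: this is the Fibonacci recursion.
\<close>

section \<open>Gapped words\<close>

text \<open>
  The pair (l, r) stands for the configuration with the checkers rev l to the left and r to the
  right of the vacancy, where True is black. As l is reversed, a slide moves one and a jump moves
  two elements between the heads of the lists, the jump without reversing their order.
\<close>

fun slideL :: "bool list \<times> bool list \<Rightarrow> (bool list \<times> bool list) list" where
  "slideL (a # l, r) = [(l, a # r)]"
| "slideL ([], r) = []"

fun slideR :: "bool list \<times> bool list \<Rightarrow> (bool list \<times> bool list) list" where
  "slideR (l, a # r) = [(a # l, r)]"
| "slideR (l, []) = []"

fun jumpL :: "bool list \<times> bool list \<Rightarrow> (bool list \<times> bool list) list" where
  "jumpL (a # b # l, r) = [(l, a # b # r)]"
| "jumpL (_, r) = []"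

fun jumpR :: "bool list \<times> bool list \<Rightarrow> (bool list \<times> bool list) list" where
  "jumpR (l, a # b # r) = [(a # b # l, r)]"
| "jumpR (l, _) = []"

definition succs :: "bool list \<times> bool list \<Rightarrow> (bool list \<times> bool list) list" where
  "succs z = slideL z @ slideR z @ jumpL z @ jumpR z"

fun num_walks :: "nat \<Rightarrow> nat \<Rightarrow> nat \<Rightarrow> bool list \<times> bool list \<Rightarrow> nat" where
  "num_walks n m 0 z = (if z = (replicate m False, replicate n True) then 1 else 0)"
| "num_walks n m (Suc t) z = (\<Sum>z'\<leftarrow>succs z. num_walks n m t z')"

text \<open>Reversal of the row combined with exchange of the colours. It maps the game with n and m
  to that with m and n, start to start and end to end, so one chain and one sweep direction
  suffice.\<close>

definition mirror :: "bool list \<times> bool list \<Rightarrow> bool list \<times> bool list" where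
  "mirror z = (map Not (snd z), map Not (fst z))"

lemma mirror_Pair [simp]: "mirror (l, r) = (map Not r, map Not l)"
  by (simp add: mirror_def)

lemma mirror_mirror [simp]: "mirror (mirror z) = z"
  by (simp add: mirror_def comp_def)

lemma slide_mirror: "slideL (mirror z) = map mirror (slideR z)" "slideR (mirror z) = map mirror (slideL z)"
proof -
  show "slideL (mirror z) = map mirror (slideR z)" by (cases z rule: slideR.cases) simp_all
  show "slideR (mirror z) = map mirror (slideL z)" by (cases z rule: slideL.cases) simp_all
qed

lemma jump_mirror: "jumpL (mirror z) = map mirror (jumpR z)" "jumpR (mirror z) = map mirror (jumpL z)"
proof -
  show "jumpL (mirror z) = map mirror (jumpR z)" by (cases z rule: jumpR.cases) simp_all
  show "jumpR (mirror z) = map mirror (jumpL z)" by (cases z rule: jumpL.cases) simp_all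
qed

lemma num_walks_mirror: "num_walks m n t (mirror z) = num_walks n m t z"
proof (induction t arbitrary: z)
  case 0
  have "mirror (replicate m False, replicate n True) = (replicate n False, replicate m True)"
    by simp
  then have "mirror z = (replicate n False, replicate m True) \<longleftrightarrow> z = (replicate m False, replicate n True)"
    by (metis mirror_mirror)
  then show ?case by simp
next
  case (Suc t)
  show ?case
    by (simp add: succs_def slide_mirror jump_mirror comp_def Suc.IH)
qed

section \<open>The potential\<close>

fun inversions :: "bool list \<Rightarrow> nat" where
  "inversions [] = 0"
| "inversions (a # w) = (if a then count_list w False else 0) + inversions w"

lemma inversions_append: "inversions (u @ v) = inversions u + inversions v + count_list u True * count_list v False"
  by (induction u) (auto simp: algebra_simps)

lemma count_flip: "count_list (map Not w) a = count_list w (\<not> a)"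
  by (induction w) auto

lemma inversions_swap: "inversions (u @ True # False # v) = Suc (inversions (u @ False # True # v))"
  by (simp add: inversions_append)

text \<open>
  If the word starts with a maximal run of x letters b, this is x; if it starts with a maximal run
  of x letters w, it is 1 - x. Up to the constant m - 1 it counts the missing cells of the border
  chain on which first all blacks pass the first white and then the last black passes all whites.
\<close>

fun lead :: "bool list \<Rightarrow> int" where
  "lead [] = 1"
| "lead (True # w) = (if w \<noteq> [] \<and> hd w then lead w + 1 else 1)"
| "lead (False # w) = (if w = [] \<or> hd w then 0 else lead w - 1)"

lemma lead_ge: "lead w \<ge> 1 - int (count_list w False)"
  by (induction w rule: lead.induct) auto

text \<open>The parity obstruction: only the swap of the next border cell changes
  \<open>lead\<close>, and then the gap, at \<open>length u\<close> or \<open>length u + 2\<close>,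
  has the parity that makes \<open>free\<close> false.\<close>

lemma lead_swap:
  "lead (u @ True # False # v) = lead (u @ False # True # v) \<or>
   lead (u @ True # False # v) = lead (u @ False # True # v) + 1 \<and>
     even (int (length u) + 1 + lead (u @ True # False # v))"
proof (induction u)
  case Nil
  show ?case by simp
next
  case (Cons a u)
  show ?case
  proof (cases u)
    case Nil
    then show ?thesis by (cases a) auto
  next
    case (Cons b u')
    \<comment> \<open>A letter equal to its successor shifts both length and \<open>lead\<close> by
      one, which keeps the parity; a different letter hides the rest from
      \<open>lead\<close>.\<close>
    have "lead (a # u @ x) = (if a = b then lead (u @ x) + (if a then 1 else - 1) else if a then 1 else 0)"
      for x
      by (cases a; cases b) (simp_all add: Cons)
    then show ?thesis using Cons.IH by auto
  qed
qed

lemma lead_run_True: "lead (replicate (Suc k) True @ False # v) = int k + 1"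
  by (induction k) auto

lemma lead_run_False: "lead (replicate (Suc k) False @ True # v) = - int k"
  by (induction k) auto

definition word :: "bool list \<times> bool list \<Rightarrow> bool list" where
  "word z = rev (fst z) @ snd z"

text \<open>The parity of the gap is the wrong one for the next swap on the chain.\<close>

definition free :: "bool list \<times> bool list \<Rightarrow> bool" where
  "free z \<longleftrightarrow> odd (int (length (fst z)) + 1 + lead (word z))"

text \<open>Missing swaps plus missing slides: at least one slide follows each missing cell of the
  chain, the last one included, and one more is due now if the parity is wrong.\<close>

definition phi :: "nat \<Rightarrow> bool list \<times> bool list \<Rightarrow> int" where
  "phi m z = int (inversions (word z)) + int m - 1 + lead (word z) + (if free z then 1 else 0)"

lemma word_mirror: "word (mirror z) = rev (map Not (word z))"
  by (simp add: word_def mirror_def rev_map)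

lemma phi_slide:
  assumes "z' \<in> set (slideL z @ slideR z)"
  shows "phi m z' = phi m z + (if free z then - 1 else 1)"
  using assms
  by (cases z rule: slideL.cases; cases z rule: slideR.cases) (auto simp: phi_def word_def free_def)

lemma word_slide: "z' \<in> set (slideL z @ slideR z) \<Longrightarrow> word z' = word z"
  by (cases z rule: slideL.cases; cases z rule: slideR.cases) (auto simp: word_def)

lemma phi_jump_same:
  "phi m (a # a # l, r) = phi m (l, a # a # r)"
  by (auto simp: phi_def word_def free_def)

text \<open>A swap off the chain lowers only the inversions. One on the chain lowers
  \<open>lead\<close> too, but the gap keeps its parity, so \<open>free\<close> becomes true and
  gives one unit back.\<close>

lemma phi_jump_left:
  "phi m (l, False # True # r) = phi m (False # True # l, r) - 1"
  using lead_swap[of "rev l" r] by (auto simp: phi_def word_def free_def inversions_swap)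

lemma phi_jump_right:
  "phi m (True # False # l, r) = phi m (l, True # False # r) - 1"
  using lead_swap[of "rev l" r] by (auto simp: phi_def word_def free_def inversions_swap)

lemma phi_jump: "phi m (a # b # l, r) = phi m (l, a # b # r) + (if a = b then 0 else if b then 1 else - 1)"
  by (cases a; cases b) (auto simp: phi_jump_same phi_jump_left phi_jump_right)

lemma phi_succs: "z' \<in> set (succs z) \<Longrightarrow> phi m z \<le> phi m z' + 1"
proof -
  have "z' \<in> set (slideL z @ slideR z) \<Longrightarrow> phi m z \<le> phi m z' + 1"
    by (simp add: phi_slide del: set_append)
  moreover have "z' \<in> set (jumpL z) \<Longrightarrow> phi m z \<le> phi m z' + 1"
    by (cases z rule: jumpL.cases) (auto simp: phi_jump)
  moreover have "z' \<in> set (jumpR z) \<Longrightarrow> phi m z \<le> phi m z' + 1"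
    by (cases z rule: jumpR.cases) (auto simp: phi_jump)
  ultimately show "z' \<in> set (succs z) \<Longrightarrow> phi m z \<le> phi m z' + 1"
    by (auto simp: succs_def)
qed

section \<open>The lower bound on the number of moves, and the states that attain it\<close>

lemma inversions_sorted: "inversions (replicate m False @ replicate n True) = 0"
proof -
  have "inversions (replicate n True) = 0" by (induction n) auto
  then show ?thesis by (induction m) auto
qed

lemma phi_final:
  assumes "m \<ge> 1" "n \<ge> 1"
  shows "phi m (replicate m False, replicate n True) = 0"
proof -
  obtain a b where "m = Suc a" "n = Suc b" using assms by (metis One_nat_def Suc_le_D)
  then show ?thesis
    using lead_run_False[of a "replicate b True"] inversions_sorted[of m n]
    by (simp del: replicate.simps add: phi_def word_def free_def) (simp add: replicate.simps(2)[of b])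
qed

lemma num_walks_eq_0_phi:
  assumes "m \<ge> 1" "n \<ge> 1"
  shows "int t < phi m z \<Longrightarrow> num_walks n m t z = 0"
proof (induction t arbitrary: z)
  case 0
  then show ?case using phi_final[OF assms] by auto
next
  case (Suc t)
  have "num_walks n m t z' = 0" if "z' \<in> set (succs z)" for z'
    using Suc phi_succs[OF that, of m] by simp
  then show ?case by simp
qed

lemma num_walks_eq_0:
  assumes "m \<ge> 1" "n \<ge> 1" "int t < phi m z \<or> int t < phi n (mirror z)"
  shows "num_walks n m t z = 0"
  using assms num_walks_eq_0_phi[of m n t z] num_walks_eq_0_phi[of n m t "mirror z"] num_walks_mirror[of m n t z] by auto

text \<open>Both lower bounds are attained, so the end is reached in t moves only if each move
  lowers both potentials.\<close>

definition tight :: "nat \<Rightarrow> nat \<Rightarrow> nat \<Rightarrow> bool list \<times> bool list \<Rightarrow> bool" where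
  "tight n m t z \<longleftrightarrow> n \<ge> 1 \<and> m \<ge> 1 \<and> phi m z = int t \<and> phi n (mirror z) = int t \<and>
     count_list (word z) False = m \<and> count_list (word z) True = n"

lemma tight_mirror: "tight m n t (mirror z) \<longleftrightarrow> tight n m t z"
  by (auto simp: tight_def word_mirror count_flip)

text \<open>The potential of the mirror image is the one belonging to the opposite border chain.\<close>

definition slidable :: "bool list \<times> bool list \<Rightarrow> bool" where
  "slidable z \<longleftrightarrow> free z \<and> free (mirror z)"

lemma tight_pos:
  assumes "tight n m t z" "slidable z \<or> inversions (word z) > 0"
  obtains t' where "t = Suc t'"
proof -
  have "int t > 0"
    using assms lead_ge[of "word z"] by (auto simp: tight_def slidable_def phi_def split: if_splits)
  then show ?thesis using that by (cases t) auto
qed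

text \<open>A slide flips just the parity terms. If one of them was right before, its potential
  rises above the number of moves left.\<close>

lemma num_walks_slide:
  assumes "tight n m (Suc t) z" "z' \<in> set (slideL z @ slideR z)"
  shows "\<not> slidable z \<Longrightarrow> num_walks n m t z' = 0"
    and "slidable z \<Longrightarrow> tight n m t z'"
proof -
  have "mirror z' \<in> set (slideL (mirror z) @ slideR (mirror z))"
    using assms(2) by (auto simp: slide_mirror)
  note eqs = phi_slide[OF assms(2), of m] phi_slide[OF this, of n] word_slide[OF assms(2)]
  show "\<not> slidable z \<Longrightarrow> num_walks n m t z' = 0"
    by (rule num_walks_eq_0) (use assms(1) eqs in \<open>auto simp: tight_def slidable_def\<close>)
  show "slidable z \<Longrightarrow> tight n m t z'"
    using assms(1) eqs by (auto simp: tight_def slidable_def)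
qed

text \<open>The left list is reversed, so its beginning \<open>[False, True]\<close> is the pair bw
  of the row.\<close>

definition fwdL :: "bool list \<times> bool list \<Rightarrow> (bool list \<times> bool list) list" where
  "fwdL z = (if take 2 (fst z) = [False, True] then jumpL z else [])"

definition fwdR :: "bool list \<times> bool list \<Rightarrow> (bool list \<times> bool list) list" where
  "fwdR z = (if take 2 (snd z) = [True, False] then jumpR z else [])"

text \<open>Jumps other than bw to wb keep or raise both potentials and leave too few moves.\<close>

lemma num_walks_jumpL:
  assumes "tight n m (Suc t) z"
  shows "(\<Sum>z'\<leftarrow>jumpL z. num_walks n m t z') = (\<Sum>z'\<leftarrow>fwdL z. num_walks n m t z')"
    and "z' \<in> set (fwdL z) \<Longrightarrow> tight n m t z'"
  using assms
  by (cases z rule: jumpL.cases;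
      auto intro!: num_walks_eq_0 simp: fwdL_def tight_def phi_jump word_def)+

lemma num_walks_jumpR:
  assumes "tight n m (Suc t) z"
  shows "(\<Sum>z'\<leftarrow>jumpR z. num_walks n m t z') = (\<Sum>z'\<leftarrow>fwdR z. num_walks n m t z')"
    and "z' \<in> set (fwdR z) \<Longrightarrow> tight n m t z'"
  using assms
  by (cases z rule: jumpR.cases;
      auto intro!: num_walks_eq_0 simp: fwdR_def tight_def phi_jump word_def)+

lemma num_walks_step:
  assumes "tight n m (Suc t) z"
  shows "num_walks n m (Suc t) z =
    (if slidable z then (\<Sum>z'\<leftarrow>slideL z @ slideR z. num_walks n m t z') else 0)
     + (\<Sum>z'\<leftarrow>fwdL z @ fwdR z. num_walks n m t z')"
proof -
  have "(\<Sum>z'\<leftarrow>slideL z @ slideR z. num_walks n m t z') = 0" if "\<not> slidable z"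
    using num_walks_slide(1)[OF assms _ that] by (simp del: set_append map_append sum_list_append)
  then show ?thesis
    using num_walks_jumpL(1)[OF assms] num_walks_jumpR(1)[OF assms]
    by (cases "slidable z") (simp_all add: succs_def)
qed

lemma num_walks_slidable:
  assumes "tight n m t z" "slidable z" "fwdL z = []" "fwdR z = []"
  obtains t' where "t = Suc t'" "num_walks n m t z = (\<Sum>z'\<leftarrow>slideL z @ slideR z. num_walks n m t' z')"
    "\<And>z'. z' \<in> set (slideL z @ slideR z) \<Longrightarrow> tight n m t' z'"
proof -
  obtain t' where t: "t = Suc t'" using tight_pos[OF assms(1)] assms(2) by blast
  note tight = assms(1)[unfolded t]
  show thesis
    using that[OF t] num_walks_step[OF tight] num_walks_slide(2)[OF tight _ assms(2)] assms(2-4)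
    by (simp add: t del: num_walks.simps set_append map_append sum_list_append)
qed

text \<open>No surviving move leaves such a state, and the last assumption keeps it from being the
  final one.\<close>

lemma num_walks_dead:
  assumes "tight n m t (l, r)" "\<not> slidable (l, r)"
    and "take 2 l \<noteq> [False, True]" "take 2 r \<noteq> [True, False]" "True \<in> set l \<or> False \<in> set r"
  shows "num_walks n m t (l, r) = 0"
proof (cases t)
  case 0
  then show ?thesis using assms(5) by auto
next
  case (Suc t')
  then show ?thesis using assms num_walks_step[of n m t' "(l, r)"]
    by (simp add: fwdL_def fwdR_def del: num_walks.simps)
qed

section \<open>Sweeps over an antidiagonal\<close>

text \<open>With signed lengths, passing to the next antidiagonal is s - 1 throughout, also where
  the run turns from b to w.\<close>

definition run :: "int \<Rightarrow> bool list" where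
  "run s = replicate (nat s) True @ replicate (nat (- s)) False"

fun alt :: "bool \<Rightarrow> nat \<Rightarrow> bool list" where
  "alt a 0 = []"
| "alt a (Suc d) = a # (\<not> a) # alt a d"

lemma rev_run [simp]: "rev (run s) = run s"
  by (cases "s \<ge> 0") (auto simp: run_def)

lemma even_length_run [simp]: "even (length (run s)) \<longleftrightarrow> even s"
  by (cases "s \<ge> 0") (auto simp: run_def even_nat_iff)

lemma run_pos:
  assumes "s \<ge> 1"
  shows "run s = True # run (s - 1)"
proof -
  from assms have "nat s = Suc (nat (s - 1))" by simp
  with assms show ?thesis by (simp add: run_def)
qed

lemma run_nonpos:
  assumes "s \<le> 0"
  shows "run (s - 1) = False # run s"
proof -
  from assms have "nat (1 - s) = Suc (nat (- s))" by simp
  with assms show ?thesis by (simp add: run_def)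
qed

lemma run_eq_replicate: "\<exists>k a. run s = replicate k a"
  by (cases "s \<ge> 0") (auto simp: run_def)

lemma take2_replicate: "a \<noteq> b \<Longrightarrow> take 2 (replicate k c) \<noteq> [a, b]"
  using set_take_subset[of 2 "replicate k c"] by (auto split: if_splits)

lemma take2_run [simp]:
  "take 2 (run s) \<noteq> [False, True]" "take 2 (map Not (run s)) \<noteq> [True, False]"
proof -
  obtain k c where "run s = replicate k c" using run_eq_replicate by blast
  then show "take 2 (run s) \<noteq> [False, True]" "take 2 (map Not (run s)) \<noteq> [True, False]"
    using take2_replicate[of False True k c] take2_replicate[of True False k "\<not> c"]
    by (simp_all del: take_replicate)
qed

lemma length_alt [simp]: "length (alt a d) = 2 * d"
  by (induction d) auto

lemma flip_alt [simp]: "map Not (alt a d) = alt (\<not> a) d"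
  by (induction d) auto

lemma alt_snoc [simp]: "alt a d @ a # w = a # alt (\<not> a) d @ w"
  by (induction d arbitrary: w) auto

lemma rev_alt [simp]: "rev (alt a d) = alt (\<not> a) d"
proof (induction d)
  case (Suc d)
  then show ?case using alt_snoc[of "\<not> a" d "[a]"] by simp
qed simp

lemma lead_run_FT: "lead (run s @ False # True # v) = s"
proof (cases "s \<ge> 1")
  case True
  then have "nat s = Suc (nat (s - 1))" by simp
  then show ?thesis using lead_run_True[of "nat (s - 1)" "True # v"] True by (simp add: run_def)
next
  case False
  then show ?thesis using lead_run_False[of "nat (- s)" v]
    by (simp add: run_def replicate_app_Cons_same)
qed

lemma lead_run_TF: "lead (run s @ True # False # v) = s + 1"
proof (cases "s \<ge> 0")
  case True
  then show ?thesis using lead_run_True[of "nat s" v]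
    by (simp add: run_def replicate_app_Cons_same)
next
  case False
  then have "nat (- s) = Suc (nat (- s - 1))" by simp
  then show ?thesis using lead_run_False[of "nat (- s - 1)" "False # v"] False by (simp add: run_def)
qed

text \<open>\<open>lead\<close> is s before wb and s + 1 before bw. Hence the same gap position is
  free after the first pair is swapped exactly if it was not free before.\<close>

lemma free_FT:
  assumes "word (l, r) = run s @ False # True # v"
  shows "free (l, r) \<longleftrightarrow> (even (length l) \<longleftrightarrow> even s)"
  using assms by (auto simp: free_def lead_run_FT)

lemma free_TF:
  assumes "word (l, r) = run s @ True # False # v"
  shows "free (l, r) \<longleftrightarrow> (even (length l) \<longleftrightarrow> odd s)"
  using assms by (auto simp: free_def lead_run_TF)

text \<open>
  Before antidiagonal k is treated, the word is X (bw)^d Y, where X is a run of n - k letters b or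
  k - n letters w, and Y is a run of m - k letters w or k - m letters b. These are the signed
  lengths s and u. In sweepR the gap has come from the right, i pairs are still to be swapped and e
  pairs are swapped already; in startL a sweep from the left begins.
\<close>

definition sweepR :: "int \<Rightarrow> int \<Rightarrow> nat \<Rightarrow> nat \<Rightarrow> bool list \<times> bool list" where
  "sweepR s u i e = (alt False i @ run s, alt False e @ map Not (run u))"

definition startL :: "int \<Rightarrow> int \<Rightarrow> nat \<Rightarrow> bool list \<times> bool list" where
  "startL s u d = (run s, alt True d @ map Not (run u))"

text \<open>Leaves only sweeps from the right to be analysed.\<close>

lemma mirror_startL: "mirror (startL s u d) = sweepR u s d 0"
  by (simp add: startL_def sweepR_def comp_def)

lemma take2_alt_False: "take 2 (alt False e @ map Not (run u)) \<noteq> [True, False]"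
  by (cases e) auto

lemma inversions_pos: "word (l, r) = u @ True # False # v \<Longrightarrow> inversions (word (l, r)) > 0"
  by (simp add: inversions_append)

text \<open>The leftmost pair is still bw, which forbids slides, and no bw follows the gap; so the
  jump to the left is forced.\<close>

lemma num_walks_sweepR_Suc:
  assumes "tight n m t (sweepR s u (Suc i) e)"
  obtains t' where "t = Suc t'" "tight n m t' (sweepR s u i (Suc e))"
    "num_walks n m t (sweepR s u (Suc i) e) = num_walks n m t' (sweepR s u i (Suc e))"
proof -
  let ?z = "sweepR s u (Suc i) e"
  have w: "word ?z = run s @ True # False # alt True i @ alt False e @ map Not (run u)"
    by (simp add: sweepR_def word_def)
  obtain t' where t: "t = Suc t'"
    using tight_pos[OF assms] w inversions_pos by (metis sweepR_def)
  note tight = assms[unfolded t]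
  have "\<not> slidable ?z"
    using w free_TF[of "fst ?z" "snd ?z"] by (simp add: slidable_def sweepR_def)
  moreover have R: "fwdR ?z = []" using take2_alt_False by (simp add: fwdR_def sweepR_def)
  moreover have L: "fwdL ?z = [sweepR s u i (Suc e)]" by (simp add: fwdL_def sweepR_def)
  ultimately show thesis
    using that[OF t] num_walks_step[OF tight] num_walks_jumpL(2)[OF tight] by (simp add: t del: num_walks.simps)
qed

lemma num_walks_sweepR_traverse:
  assumes "tight n m t (sweepR s u i e)"
  obtains t' where "t' \<le> t" "tight n m t' (sweepR s u 0 (i + e))"
    "num_walks n m t (sweepR s u i e) = num_walks n m t' (sweepR s u 0 (i + e))"
  using assms
proof (induction i arbitrary: t e thesis)
  case 0
  from 0(1)[OF le_refl] 0(2) show ?case by simp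
next
  case (Suc i)
  obtain t1 where 1: "t = Suc t1" "tight n m t1 (sweepR s u i (Suc e))"
    "num_walks n m t (sweepR s u (Suc i) e) = num_walks n m t1 (sweepR s u i (Suc e))"
    using num_walks_sweepR_Suc[OF Suc.prems(2)] by blast
  obtain t2 where 2: "t2 \<le> t1" "tight n m t2 (sweepR s u 0 (i + Suc e))"
    "num_walks n m t1 (sweepR s u i (Suc e)) = num_walks n m t2 (sweepR s u 0 (i + Suc e))"
    using Suc.IH[OF _ 1(2)] by blast
  show ?case
    using Suc.prems(1)[of t2] 1 2 by simp
qed

text \<open>Both ends of the antidiagonal are now wb, so both chains ask for a slide, and no bw is
  next to the gap. Only the direction of the slide is open.\<close>

lemma num_walks_complete:
  assumes "tight n m t (sweepR s u 0 (Suc e))"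
  obtains t' where "t = Suc t'"
    "num_walks n m t (sweepR s u 0 (Suc e)) =
      (\<Sum>z'\<leftarrow>slideL (sweepR s u 0 (Suc e)) @ slideR (sweepR s u 0 (Suc e)). num_walks n m t' z')"
    "\<And>z'. z' \<in> set (slideL (sweepR s u 0 (Suc e)) @ slideR (sweepR s u 0 (Suc e))) \<Longrightarrow> tight n m t' z'"
proof -
  let ?z = "sweepR s u 0 (Suc e)"
  have "free ?z"
    using free_FT[of "fst ?z" "snd ?z" s] by (simp add: sweepR_def word_def)
  moreover have "free (mirror ?z)"
    using free_FT[of "fst (mirror ?z)" "snd (mirror ?z)" u "alt False e @ map Not (run s)"]
    by (simp add: sweepR_def word_def comp_def)
  ultimately have "slidable ?z" by (simp add: slidable_def)
  moreover have "fwdR ?z = []" using take2_alt_False[of "Suc e"] by (simp add: fwdR_def sweepR_def)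
  moreover have "fwdL ?z = []" by (simp add: fwdL_def sweepR_def)
  ultimately show thesis using num_walks_slidable[OF assms] that by metis
qed

text \<open>Regroup b(wb)^d Y as (bw)^d bY: the last b forms a new pair with a leading w of Y, or
  else extends Y, which then has no w.\<close>

lemma alt_run_shift:
  "True # alt False d @ map Not (run u) = alt True (d + of_bool (u \<ge> 1)) @ map Not (run (u - 1))"
proof (cases "u \<ge> 1")
  case True
  then show ?thesis by (simp add: run_pos)
next
  case False
  then show ?thesis by (simp add: run_nonpos)
qed

lemma slideL_complete_pos:
  "s \<ge> 1 \<Longrightarrow> slideL (sweepR s u 0 d) = [startL (s - 1) (u - 1) (d + of_bool (u \<ge> 1))]"
  by (simp add: sweepR_def startL_def run_pos alt_run_shift)

text \<open>The w passed and the last b of X form the first pair of the next antidiagonal. The gap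
  stands behind this pair: in the interior, unless it is the only pair.\<close>

lemma slideR_complete_pos:
  "s \<ge> 1 \<Longrightarrow> slideR (sweepR s u 0 (Suc e)) =
     [(False # True # run (s - 1), alt True (e + of_bool (u \<ge> 1)) @ map Not (run (u - 1)))]"
  by (simp add: sweepR_def run_pos alt_run_shift)

lemma slideR_complete_nonpos:
  "s \<le> 0 \<Longrightarrow> slideR (sweepR s u 0 (Suc e)) = [startL (s - 1) (u - 1) (e + of_bool (u \<ge> 1))]"
  by (simp add: sweepR_def startL_def run_nonpos alt_run_shift)

text \<open>X consists of w only. After the slide the parity forbids another one, and with only w on
  the left and ww on the right there is no pair to swap.\<close>

lemma slideL_complete_nonpos:
  assumes "s \<le> 0" "z' \<in> set (slideL (sweepR s u 0 (Suc e)))" "tight n m t z'"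
  shows "num_walks n m t z' = 0"
proof -
  have "s \<noteq> 0" using assms by (auto simp: sweepR_def run_def)
  then have s: "s < 0" using assms(1) by simp
  then have r: "run s = False # run (s + 1)" using run_nonpos[of "s + 1"] by simp
  let ?r = "False # alt False (Suc e) @ map Not (run u)"
  have z': "z' = (run (s + 1), ?r)" using assms(2) r by (simp add: sweepR_def)
  have "word z' = run s @ False # True # alt False e @ map Not (run u)"
    using arg_cong[OF r, of rev] by (simp add: z' word_def)
  then have "\<not> slidable z'" using free_FT by (simp add: z' slidable_def)
  with assms(3) show ?thesis unfolding z' by (intro num_walks_dead) auto
qed

text \<open>
  A sweep begun in the interior of the antidiagonal gets stuck at one of its ends, since the
  unfinished cells on the other side forbid the slide.
\<close>

lemma num_walks_interior:
  assumes "tight n m t (alt True i @ False # True # run s, alt True e @ map Not (run u))"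
    and "i \<noteq> 0 \<or> e \<noteq> 0"
  shows "num_walks n m t (alt True i @ False # True # run s, alt True e @ map Not (run u)) = 0"
  using assms
proof (induction e arbitrary: i t)
  case 0
  then obtain j where i: "i = Suc j" by (cases i) auto
  let ?z = "(alt True i @ False # True # run s, alt True 0 @ map Not (run u))"
  have "\<not> free ?z" using free_TF[of _ _ s] by (simp add: word_def)
  then show ?case
    using 0 by (intro num_walks_dead) (auto simp: slidable_def i)
next
  case (Suc e)
  let ?r = "alt True e @ map Not (run u)"
  let ?z = "(alt True i @ False # True # run s, True # False # ?r)"
  have tight: "tight n m t ?z" using Suc.prems by simp
  have "inversions (word ?z) > 0" by (simp add: word_def inversions_append)
  then obtain t' where t: "t = Suc t'" using tight_pos[OF tight] by blast
  note tight' = tight[unfolded t]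
  have "\<not> free ?z" using free_TF[of _ _ s] by (simp add: word_def)
  then have ns: "\<not> slidable ?z" by (simp add: slidable_def)
  have R: "fwdR ?z = [(alt True (Suc i) @ False # True # run s, ?r)]" by (simp add: fwdR_def)
  have 1: "num_walks n m t' (alt True (Suc i) @ False # True # run s, ?r) = 0"
    by (rule Suc.IH) (use num_walks_jumpR(2)[OF tight'] R in auto)
  \<comment> \<open>A jump back over bw needs i = 0 and swaps the first pair. The gap is then at the
    left end, while the last pair, still bw, blocks the slide through the mirrored chain.\<close>
  have 2: "num_walks n m t' z' = 0" if z': "z' \<in> set (fwdL ?z)" for z'
  proof -
    have "i = 0" using z' by (cases i) (auto simp: fwdL_def)
    then have eq: "z' = (run s, False # True # True # False # ?r)" using z' by (simp add: fwdL_def)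
    have "word (mirror z') = run u @ True # False # alt True e @ False # True # map Not (run s)"
      by (simp add: eq word_def comp_def)
    then have "\<not> slidable z'" using free_TF by (simp add: eq slidable_def comp_def)
    with num_walks_jumpL(2)[OF tight' z'] show ?thesis unfolding eq by (intro num_walks_dead) auto
  qed
  show ?case
    using num_walks_step[OF tight'] ns R 1 2 by (simp add: t del: num_walks.simps)
qed

section \<open>Recursion from one antidiagonal to the next\<close>

lemma count_list_replicate: "count_list (replicate k a) b = (if a = b then k else 0)"
  by (induction k) auto

lemma count_run: "count_list (run s) True = nat s" "count_list (run s) False = nat (- s)"
  by (simp_all add: run_def count_list_replicate)

lemma count_alt [simp]: "count_list (alt a d) b = d"
  by (induction d) auto

lemma tight_sweepR:
  assumes "tight n m t (sweepR s u i e)"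
  shows "n = i + e + nat s + nat (- u)" "m = i + e + nat (- s) + nat u" "1 \<le> n" "1 \<le> m"
  using assms by (auto simp: tight_def sweepR_def word_def count_run count_flip)

text \<open>One round: a sweep and the slide after it. The second assumption excludes a next
  antidiagonal of one cell with s >= 1, where both slides survive.\<close>

lemma num_walks_sweepR_next:
  assumes "tight n m t (sweepR s u (Suc e) 0)" "s \<ge> 1 \<longrightarrow> e + of_bool (u \<ge> 1) \<noteq> 0"
  obtains t' where "t' < t" "tight n m t' (startL (s - 1) (u - 1) (e + of_bool (s \<ge> 1) + of_bool (u \<ge> 1)))"
    "num_walks n m t (sweepR s u (Suc e) 0) =
       num_walks n m t' (startL (s - 1) (u - 1) (e + of_bool (s \<ge> 1) + of_bool (u \<ge> 1)))"
proof -
  let ?z = "sweepR s u 0 (Suc e)"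
  obtain t1 where 1: "t1 \<le> t" "tight n m t1 ?z" "num_walks n m t (sweepR s u (Suc e) 0) = num_walks n m t1 ?z"
    using num_walks_sweepR_traverse[OF assms(1)] by auto
  obtain t2 where 2: "t1 = Suc t2"
    "num_walks n m t1 ?z = (\<Sum>z'\<leftarrow>slideL ?z @ slideR ?z. num_walks n m t2 z')"
    "\<And>z'. z' \<in> set (slideL ?z @ slideR ?z) \<Longrightarrow> tight n m t2 z'"
    using num_walks_complete[OF 1(2)] by blast
  show thesis
  proof (cases "s \<ge> 1")
    case True
    note slides = slideL_complete_pos[OF True, of u "Suc e"] slideR_complete_pos[OF True, of u e]
    have "num_walks n m t2 z' = 0" if "z' \<in> set (slideR ?z)" for z'
      using num_walks_interior[of n m t2 0] that 2(3)[of z'] assms(2) True by (simp add: slides)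
    then show thesis
      using that[of t2] 1 2 True by (simp add: slides)
  next
    case False
    note slides = slideR_complete_nonpos[of s u e]
    have "num_walks n m t2 z' = 0" if "z' \<in> set (slideL ?z)" for z'
      using slideL_complete_nonpos[of s z' u e n m t2] that 2(3)[of z'] False by simp
    then show thesis
      using that[of t2] 1 2 False by (simp add: slides)
  qed
qed

lemma num_walks_final:
  assumes "tight n m t (sweepR s u 0 0)" "s \<le> 0" "u \<le> 0"
  shows "num_walks n m t (sweepR s u 0 0) = 1"
proof -
  have eq: "sweepR s u 0 0 = (replicate m False, replicate n True)"
    using tight_sweepR[OF assms(1)] assms(2,3) by (simp add: sweepR_def run_def)
  then have "t = 0" using assms(1) phi_final[of m n] by (simp add: tight_def)
  then show ?thesis by (simp add: eq)
qed

text \<open>Sweeps alternate in direction; mirroring after each one exchanges n with m and s with u,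
  so a single induction on the moves left covers both directions.\<close>

lemma num_walks_sweepR_ge2:
  assumes "n \<ge> 2" "m \<ge> 2" "tight n m t (sweepR s u d 0)" "d = 0 \<longrightarrow> s \<le> 0 \<and> u \<le> 0"
  shows "num_walks n m t (sweepR s u d 0) = 1"
  using assms
proof (induction t arbitrary: n m s u d rule: less_induct)
  case (less t)
  show ?case
  proof (cases d)
    case 0
    then show ?thesis using num_walks_final less.prems by blast
  next
    case (Suc e)
    note tight = less.prems(3)[unfolded Suc]
    let ?d = "e + of_bool (s \<ge> 1) + of_bool (u \<ge> 1)"
    \<comment> \<open>Otherwise e = 0 and u <= 0, and counting the w's gives m = 1.\<close>
    have "s \<ge> 1 \<longrightarrow> e + of_bool (u \<ge> 1) \<noteq> 0"
      using tight_sweepR(2)[OF tight] less.prems(2) by auto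
    then obtain t' where t': "t' < t" "tight n m t' (startL (s - 1) (u - 1) ?d)"
      "num_walks n m t (sweepR s u (Suc e) 0) = num_walks n m t' (startL (s - 1) (u - 1) ?d)"
      using num_walks_sweepR_next[OF tight] by blast
    have "num_walks m n t' (sweepR (u - 1) (s - 1) ?d 0) = 1"
      by (rule less.IH) (use t' less.prems tight_mirror[of m n t'] in \<open>auto simp flip: mirror_startL\<close>)
    then show ?thesis using t'(3) num_walks_mirror[of m n t'] by (simp add: Suc flip: mirror_startL)
  qed
qed

text \<open>With x + 1 letters b in X, a sweep to the left leaves both entrances to the next cell,
  which gives fib (x + 1) + fib (x + 2); a sweep to the right leaves only the one from the right,
  which gives fib (x + 2).\<close>

lemma num_walks_one_white:
  "tight n 1 t (sweepR (int x) u 1 0) \<Longrightarrow> u \<le> 0 \<Longrightarrow> num_walks n 1 t (sweepR (int x) u 1 0) = fib (x + 2)"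
  "tight n 1 t (startL (int x) u 1) \<Longrightarrow> u \<le> 0 \<Longrightarrow> num_walks n 1 t (startL (int x) u 1) = fib (x + 1)"
proof (induction x arbitrary: t u)
  case 0
  {
    case 1
    obtain t' where "tight n 1 t' (startL (- 1) (u - 1) 0)"
      "num_walks n 1 t (sweepR 0 u 1 0) = num_walks n 1 t' (startL (- 1) (u - 1) 0)"
      using num_walks_sweepR_next[of n 1 t 0 u 0] 1 by auto
    moreover have "startL (- 1) (u - 1) 0 = sweepR (- 1) (u - 1) 0 0" by (simp add: startL_def sweepR_def)
    ultimately show ?case using num_walks_final[of n 1 t' "-1" "u - 1"] 1 by simp
  next
    case 2
    obtain t' where "tight 1 n t' (startL (u - 1) (- 1) 0)"
      "num_walks 1 n t (sweepR u 0 1 0) = num_walks 1 n t' (startL (u - 1) (- 1) 0)"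
      using num_walks_sweepR_next[of 1 n t u 0 0] 2 tight_mirror[of 1 n t "startL 0 u 1"] by (auto simp: mirror_startL)
    moreover have "startL (u - 1) (- 1) 0 = sweepR (u - 1) (- 1) 0 0" by (simp add: startL_def sweepR_def)
    ultimately show ?case using num_walks_final[of 1 n t' "u - 1" "-1"] 2 num_walks_mirror[of 1 n t "startL 0 u 1"]
      by (simp add: mirror_startL)
  }
next
  case (Suc x)
  {
    case 1
    let ?z = "sweepR (int (Suc x)) u 0 1"
    obtain t1 where t1: "tight n 1 t1 ?z" "num_walks n 1 t (sweepR (int (Suc x)) u 1 0) = num_walks n 1 t1 ?z"
      using num_walks_sweepR_traverse[OF 1(1)] by auto
    obtain t2 where t2: "num_walks n 1 t1 ?z = (\<Sum>z'\<leftarrow>slideL ?z @ slideR ?z. num_walks n 1 t2 z')"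
      "\<And>z'. z' \<in> set (slideL ?z @ slideR ?z) \<Longrightarrow> tight n 1 t2 z'"
      using num_walks_complete[of n 1 t1 "int (Suc x)" u 0, folded One_nat_def, OF t1(1)] by blast
    have L: "slideL ?z = [startL (int x) (u - 1) 1]"
      using slideL_complete_pos[of "int (Suc x)" u 1] 1 by simp
    have R: "slideR ?z = [sweepR (int x) (u - 1) 1 0]"
      using slideR_complete_pos[of "int (Suc x)" u 0] 1 by (simp add: sweepR_def)
    show ?case
      using t1 t2 L R Suc.IH[of t2 "u - 1"] 1 by simp
  next
    case 2
    obtain t' where t': "tight 1 n t' (startL (u - 1) (int x) 1)"
      "num_walks 1 n t (sweepR u (int (Suc x)) 1 0) = num_walks 1 n t' (startL (u - 1) (int x) 1)"
      using num_walks_sweepR_next[of 1 n t u "int (Suc x)" 0] 2 tight_mirror[of 1 n t "startL (int (Suc x)) u 1"]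
      by (auto simp: mirror_startL)
    then have "tight n 1 t' (sweepR (int x) (u - 1) 1 0)" using tight_mirror[of n 1 t'] by (simp flip: mirror_startL)
    then show ?case
      using t' Suc.IH(1)[of t' "u - 1"] 2 num_walks_mirror[of 1 n t "startL (int (Suc x)) u 1"]
        num_walks_mirror[of n 1 t' "startL (u - 1) (int x) 1"]
      by (simp add: mirror_startL)
  }
qed

section \<open>The initial state\<close>

lemma tight_init:
  assumes "n \<ge> 1" "m \<ge> 1"
  shows "tight n m (n * m + n + m) (sweepR (int n) (int m) 0 0)" "slidable (sweepR (int n) (int m) 0 0)"
proof -
  have w: "word (replicate a True, replicate b False) = replicate a True @ replicate b False"
    "map Not (replicate a True) = replicate a False" for a b by (simp_all add: word_def)
  have 1: "lead (replicate a True @ replicate b False) = int a" if "a \<ge> 1" "b \<ge> 1" for a b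
    using lead_run_True[of "a - 1" "replicate (b - 1) False"] that
    by (simp flip: replicate_Suc)
  have 2: "free (replicate a True, replicate b False)" if "a \<ge> 1" "b \<ge> 1" for a b
    using 1[OF that] by (simp add: free_def w)
  have 3: "inversions (replicate a True @ replicate b False) = a * b" for a b
  proof -
    have "inversions (replicate b False) = 0" by (induction b) auto
    then show ?thesis by (induction a) (auto simp: count_list_replicate)
  qed
  \<comment> \<open>There are ab swaps, a + b - 1 border cells, and one slide for the wrong
    parity.\<close>
  have 4: "phi b (replicate a True, replicate b False) = int (a * b + a + b)" if "a \<ge> 1" "b \<ge> 1" for a b
    using 1 2 3 that by (simp add: phi_def w)
  have z: "sweepR (int n) (int m) 0 0 = (replicate n True, replicate m False)"
    by (simp add: sweepR_def run_def)
  show "tight n m (n * m + n + m) (sweepR (int n) (int m) 0 0)"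
    using 4[of n m] 4[of m n] assms by (simp add: tight_def z w count_list_replicate algebra_simps)
  show "slidable (sweepR (int n) (int m) 0 0)"
    using 2[of n m] 2[of m n] assms by (simp add: slidable_def z)
qed

text \<open>The first antidiagonal is a single corner cell, and each of the two first slides enters
  it from one side.\<close>

lemma num_walks_init:
  assumes "n \<ge> 1" "m \<ge> 1"
  obtains t where "tight n m t (startL (int n - 1) (int m - 1) 1)" "tight n m t (sweepR (int n - 1) (int m - 1) 1 0)"
    "num_walks n m (n * m + n + m) (sweepR (int n) (int m) 0 0) =
       num_walks n m t (startL (int n - 1) (int m - 1) 1) + num_walks n m t (sweepR (int n - 1) (int m - 1) 1 0)"
proof -
  let ?z = "sweepR (int n) (int m) 0 0"
  have "fwdL ?z = []" "fwdR ?z = []" by (simp_all add: fwdL_def fwdR_def sweepR_def)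
  then obtain t where t: "num_walks n m (n * m + n + m) ?z = (\<Sum>z'\<leftarrow>slideL ?z @ slideR ?z. num_walks n m t z')"
    "\<And>z'. z' \<in> set (slideL ?z @ slideR ?z) \<Longrightarrow> tight n m t z'"
    using num_walks_slidable tight_init[OF assms] by metis
  have "slideL ?z = [startL (int n - 1) (int m - 1) 1]" "slideR ?z = [sweepR (int n - 1) (int m - 1) 1 0]"
    using assms run_pos[of "int n"] run_pos[of "int m"] by (simp_all add: sweepR_def startL_def)
  with t show thesis by (intro that[of t]) simp_all
qed

lemma num_walks_init_one:
  assumes "n \<ge> 1"
  shows "num_walks n 1 (n * 1 + n + 1) (sweepR (int n) (int 1) 0 0) = fib (n + 2)"
proof -
  obtain x where x: "n = Suc x" using assms by (cases n) auto
  obtain t where "tight n 1 t (startL (int x) 0 1)" "tight n 1 t (sweepR (int x) 0 1 0)"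
    "num_walks n 1 (n * 1 + n + 1) (sweepR (int n) (int 1) 0 0) = num_walks n 1 t (startL (int x) 0 1) + num_walks n 1 t (sweepR (int x) 0 1 0)"
    using num_walks_init[of n 1] by (auto simp: x)
  then show ?thesis using num_walks_one_white[of n t x 0] x by simp
qed

lemma num_walks_init_ge2:
  assumes "n \<ge> 2" "m \<ge> 2"
  shows "num_walks n m (n * m + n + m) (sweepR (int n) (int m) 0 0) = 2"
proof -
  obtain t where t: "tight n m t (startL (int n - 1) (int m - 1) 1)" "tight n m t (sweepR (int n - 1) (int m - 1) 1 0)"
    "num_walks n m (n * m + n + m) (sweepR (int n) (int m) 0 0) =
       num_walks n m t (startL (int n - 1) (int m - 1) 1) + num_walks n m t (sweepR (int n - 1) (int m - 1) 1 0)"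
    using num_walks_init[of n m] assms by auto
  have "num_walks n m t (sweepR (int n - 1) (int m - 1) 1 0) = 1"
    using num_walks_sweepR_ge2 assms t(2) by simp
  moreover have "num_walks m n t (sweepR (int m - 1) (int n - 1) 1 0) = 1"
    using num_walks_sweepR_ge2 assms t(1) tight_mirror[of m n t] by (simp flip: mirror_startL)
  ultimately show ?thesis using t(3) num_walks_mirror[of m n t] by (simp flip: mirror_startL)
qed

section \<open>Counting paths of configurations\<close>

fun colour :: "bool \<Rightarrow> cell" where
  "colour True = Bk"
| "colour False = Wh"

definition conf :: "bool list \<times> bool list \<Rightarrow> cell list" where
  "conf z = map colour (rev (fst z)) @ Vac # map colour (snd z)"

lemma colour_neq_Vac [simp]: "colour a \<noteq> Vac" "Vac \<noteq> colour a"
  by (cases a; simp)+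

lemma inj_colour: "inj colour"
proof (rule injI)
  fix a b assume "colour a = colour b" then show "a = b" by (cases a; cases b) auto
qed

lemma inj_conf: "inj conf"
proof (rule injI)
  fix y z assume eq: "conf y = conf z"
  have "Vac \<notin> set (map colour w)" for w by auto
  then have "map colour (rev (fst y)) = map colour (rev (fst z)) \<and> map colour (snd y) = map colour (snd z)"
    using eq append_Cons_eq_iff[of Vac] by (simp add: conf_def)
  then show "y = z" using inj_colour by (simp add: inj_map_eq_map prod_eq_iff)
qed

lemma conf_nth_Vac: "i < length (conf (l, r)) \<Longrightarrow> conf (l, r) ! i = Vac \<longleftrightarrow> i = length l"
  by (auto simp: conf_def nth_append nth_Cons split: nat.splits)

lemma move_confI: "z' \<in> set (succs z) \<Longrightarrow> move (conf z) (conf z')"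
proof -
  have sR: "move (conf (l, a # r)) (conf (a # l, r))" for l a r
    unfolding move_def
    by (rule exI[of _ "length l"], rule exI[of _ "length l + 1"])
       (simp add: conf_def nth_append list_update_append)
  have sL: "move (conf (a # l, r)) (conf (l, a # r))" for l a r
    unfolding move_def
    by (rule exI[of _ "length l + 1"], rule exI[of _ "length l"])
       (simp add: conf_def nth_append list_update_append)
  have jR: "move (conf (l, a # b # r)) (conf (a # b # l, r))" for l a b r
    unfolding move_def
    by (rule exI[of _ "length l"], rule exI[of _ "length l + 2"])
       (simp add: conf_def nth_append list_update_append)
  have jL: "move (conf (a # b # l, r)) (conf (l, a # b # r))" for l a b r
    unfolding move_def
    by (rule exI[of _ "length l + 2"], rule exI[of _ "length l"])
       (simp add: conf_def nth_append list_update_append)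
  assume "z' \<in> set (succs z)"
  then consider "z' \<in> set (slideL z)" | "z' \<in> set (slideR z)" | "z' \<in> set (jumpL z)" | "z' \<in> set (jumpR z)"
    by (auto simp: succs_def)
  then show "move (conf z) (conf z')"
  proof cases
    case 1 then show ?thesis using sL by (cases z rule: slideL.cases) auto
  next
    case 2 then show ?thesis using sR by (cases z rule: slideR.cases) auto
  next
    case 3 then show ?thesis using jL by (cases z rule: jumpL.cases) auto
  next
    case 4 then show ?thesis using jR by (cases z rule: jumpR.cases) auto
  qed
qed

lemma move_confD:
  assumes "move (conf z) c"
  shows "c \<in> conf ` set (succs z)"
proof -
  obtain l r where z: "z = (l, r)" by (cases z)
  obtain i j where ij: "i < length (conf z)" "j < length (conf z)" "conf z ! i = Vac"
    "j = i + 1 \<or> i = j + 1 \<or> j = i + 2 \<or> i = j + 2" "c = (conf z)[i := conf z ! j, j := Vac]"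
    using assms unfolding move_def by blast
  have i: "i = length l" using ij conf_nth_Vac by (simp add: z)
  have len: "length (conf z) = length l + length r + 1" by (simp add: z conf_def)
  from ij(4) consider "j = i + 1" | "i = j + 1" | "j = i + 2" | "i = j + 2" by blast
  then show ?thesis
  proof cases
    case 1
    then obtain a r' where "r = a # r'" using ij(2) len i by (cases r) auto
    then have "c = conf (a # l, r')" "(a # l, r') \<in> set (succs z)"
      using 1 ij(5) i by (simp_all add: z conf_def nth_append list_update_append succs_def)
    then show ?thesis by blast
  next
    case 2
    then obtain a l' where "l = a # l'" using i by (cases l) auto
    then have "c = conf (l', a # r)" "(l', a # r) \<in> set (succs z)"
      using 2 ij(5) i by (simp_all add: z conf_def nth_append list_update_append succs_def)
    then show ?thesis by blast
  next
    case 3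
    then obtain a b r' where "r = a # b # r'" using ij(2) len i by (cases r; cases "tl r") auto
    then have "c = conf (a # b # l, r')" "(a # b # l, r') \<in> set (succs z)"
      using 3 ij(5) i by (simp_all add: z conf_def nth_append list_update_append succs_def)
    then show ?thesis by blast
  next
    case 4
    then obtain a b l' where "l = a # b # l'" using i by (cases l; cases "tl l") auto
    then have "c = conf (l', a # b # r)" "(l', a # b # r) \<in> set (succs z)"
      using 4 ij(5) i by (simp_all add: z conf_def nth_append list_update_append succs_def)
    then show ?thesis by blast
  qed
qed

text \<open>The four kinds of move lead to different gap positions. Hence the list sum in
  \<open>num_walks\<close> counts no successor twice.\<close>

lemma distinct_succs: "distinct (succs z)"
proof -
  obtain l r where z: "z = (l, r)" by (cases z)
  have L: "length (fst z') + 1 = length l" if "z' \<in> set (slideL z)" for z'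
    using that by (cases l) (auto simp: z)
  have R: "length (fst z') = length l + 1" if "z' \<in> set (slideR z)" for z'
    using that by (cases r) (auto simp: z)
  have JL: "length (fst z') + 2 = length l" if "z' \<in> set (jumpL z)" for z'
    using that by (cases "(l, r)" rule: jumpL.cases) (auto simp: z)
  have JR: "length (fst z') = length l + 2" if "z' \<in> set (jumpR z)" for z'
    using that by (cases "(l, r)" rule: jumpR.cases) (auto simp: z)
  have "distinct (slideL z)" by (cases z rule: slideL.cases) auto
  moreover have "distinct (slideR z)" by (cases z rule: slideR.cases) auto
  moreover have "distinct (jumpL z)" by (cases z rule: jumpL.cases) auto
  moreover have "distinct (jumpR z)" by (cases z rule: jumpR.cases) auto
  ultimately show ?thesis
    unfolding succs_def distinct_append by (auto dest!: L R JL JR)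
qed

text \<open>The start is arbitrary and \<open>states\<close> is not mentioned, which permits
  recursion on the first move; \<open>paths_eq_walks\<close> returns to \<open>paths\<close>, as
  moves preserve \<open>states\<close>.\<close>

definition walks :: "nat \<Rightarrow> nat \<Rightarrow> cell list \<Rightarrow> nat \<Rightarrow> cell list list set" where
  "walks n m c k = {ps. length ps = Suc k \<and> hd ps = c \<and> last ps = final_conf n m \<and>
                        (\<forall>i<k. move (ps ! i) (ps ! Suc i))}"

lemma walks_0: "walks n m c 0 = (if c = final_conf n m then {[c]} else {})"
  by (auto simp: walks_def length_Suc_conv)

lemma walks_Suc: "walks n m c (Suc k) = (#) c ` (\<Union>c'\<in>{c'. move c c'}. walks n m c' k)"
proof (intro equalityI subsetI)
  fix ps assume "ps \<in> walks n m c (Suc k)"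
  then obtain qs where qs: "ps = c # qs" "length qs = Suc k" "last ps = final_conf n m"
    "\<forall>i<Suc k. move (ps ! i) (ps ! Suc i)"
    by (auto simp: walks_def length_Suc_conv)
  then have "qs \<noteq> []" by auto
  then have "move c (hd qs)" "last qs = final_conf n m" "\<forall>i<k. move (qs ! i) (qs ! Suc i)"
    using qs by (auto simp: hd_conv_nth)
  then show "ps \<in> (#) c ` (\<Union>c'\<in>{c'. move c c'}. walks n m c' k)"
    using qs by (auto simp: walks_def)
next
  fix ps assume "ps \<in> (#) c ` (\<Union>c'\<in>{c'. move c c'}. walks n m c' k)"
  then obtain qs where qs: "ps = c # qs" "move c (hd qs)" "length qs = Suc k" "last qs = final_conf n m"
    "\<forall>i<k. move (qs ! i) (qs ! Suc i)"
    by (auto simp: walks_def)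
  then have "qs \<noteq> []" by auto
  then show "ps \<in> walks n m c (Suc k)"
    using qs by (auto simp: walks_def hd_conv_nth nth_Cons split: nat.splits)
qed

lemma conf_final: "conf (replicate m False, replicate n True) = final_conf n m"
  by (simp add: conf_def final_conf_def)

lemma card_walks: "finite (walks n m (conf z) k) \<and> card (walks n m (conf z) k) = num_walks n m k z"
proof (induction k arbitrary: z)
  case 0
  then show ?case
    using inj_eq[OF inj_conf, of z "(replicate m False, replicate n True)"]
    by (simp add: walks_0 conf_final)
next
  case (Suc k)
  have "{c'. move (conf z) c'} = conf ` set (succs z)"
    using move_confI move_confD by blast
  then have eq: "walks n m (conf z) (Suc k) = (#) (conf z) ` (\<Union>z'\<in>set (succs z). walks n m (conf z') k)"
    by (simp add: walks_Suc)
  have "card (\<Union>z'\<in>set (succs z). walks n m (conf z') k) = (\<Sum>z'\<in>set (succs z). card (walks n m (conf z') k))"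
  proof (rule card_UN_disjoint)
    show "\<forall>y\<in>set (succs z). \<forall>z'\<in>set (succs z). y \<noteq> z' \<longrightarrow> walks n m (conf y) k \<inter> walks n m (conf z') k = {}"
      using inj_eq[OF inj_conf] by (fastforce simp: walks_def)
  qed (use Suc in auto)
  also have "\<dots> = num_walks n m (Suc k) z"
    using Suc by (simp add: sum_list_distinct_conv_sum_set distinct_succs)
  finally show ?case
    using Suc by (simp add: eq card_image del: num_walks.simps)
qed

lemma move_states:
  assumes "move c c'" "c \<in> states n m"
  shows "c' \<in> states n m"
proof -
  obtain i j where "i < length c" "j < length c" "c ! i = Vac" "c' = c[i := c ! j, j := Vac]"
    using assms(1) unfolding move_def by blast
  then have "mset c' = mset c" using mset_swap[of j c i] by simp
  then have "count_list c' x = count_list c x" "length c' = length c" for x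
    by (metis count_mset, metis size_mset)
  then show ?thesis using assms(2) by (simp add: states_def)
qed

lemma paths_eq_walks: "paths n m k = walks n m (init_conf n m) k"
proof -
  have "set ps \<subseteq> states n m" if "ps \<in> walks n m (init_conf n m) k" for ps
  proof -
    have "ps ! i \<in> states n m" if "i \<le> k" for i
      using that
    proof (induction i)
      case 0
      have "ps ! 0 = init_conf n m"
        using \<open>ps \<in> _\<close> by (cases ps) (auto simp: walks_def)
      then show ?case by (simp add: states_def init_conf_def count_list_replicate)
    next
      case (Suc i)
      then show ?case
        using \<open>ps \<in> _\<close> move_states[of "ps ! i" "ps ! Suc i"] by (simp add: walks_def)
    qed
    then show ?thesis
      using \<open>ps \<in> _\<close> by (auto simp: walks_def in_set_conv_nth)
  qed
  then show ?thesis by (auto simp: paths_def walks_def)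
qed

text \<open>The potential of the initial state excludes shorter paths, and the nonzero count itself
  supplies a path of this length.\<close>

lemma num_opt_eq_num_walks:
  assumes "n \<ge> 1" "m \<ge> 1" "num_walks n m (n * m + n + m) (sweepR (int n) (int m) 0 0) \<noteq> 0"
  shows "num_opt n m = num_walks n m (n * m + n + m) (sweepR (int n) (int m) 0 0)"
proof -
  let ?z = "sweepR (int n) (int m) 0 0"
  have "conf ?z = init_conf n m"
    by (simp add: sweepR_def run_def conf_def init_conf_def)
  then have paths: "finite (paths n m k)" "card (paths n m k) = num_walks n m k ?z" for k
    using card_walks[of n m ?z k] by (simp_all add: paths_eq_walks)
  have "opt_len n m = n * m + n + m"
    unfolding opt_len_def
  proof (rule Least_equality)
    show "paths n m (n * m + n + m) \<noteq> {}" using paths assms(3) by (metis card.empty)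
    fix k assume "paths n m k \<noteq> {}"
    then have "num_walks n m k ?z \<noteq> 0" using paths by (metis card_0_eq)
    then show "n * m + n + m \<le> k"
      using num_walks_eq_0_phi[of m n k ?z] tight_init(1)[OF assms(1,2)] assms(1,2)
      unfolding tight_def by linarith
  qed
  then show ?thesis using paths(2) by (simp add: num_opt_def)
qed

theorem theorem4:
  fixes n m :: nat
  assumes "1 \<le> m" and "m \<le> n"
  shows "(m = 1 \<longrightarrow>
            real (num_opt n m) =
              1 / sqrt 5 * (((1 + sqrt 5) / 2) ^ (n + 2) - ((1 - sqrt 5) / 2) ^ (n + 2))
            \<and> num_opt n m = fib (n + 2))
       \<and> (1 < m \<longrightarrow> num_opt n m = 2)"
proof (intro conjI impI)
  assume "m = 1"
  then show fib: "num_opt n m = fib (n + 2)"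
    using num_opt_eq_num_walks[of n m] num_walks_init_one[of n] assms fib_neq_0_nat[of "n + 2"] by (simp del: num_walks.simps)
  show "real (num_opt n m) =
              1 / sqrt 5 * (((1 + sqrt 5) / 2) ^ (n + 2) - ((1 - sqrt 5) / 2) ^ (n + 2))"
    unfolding fib fib_closed_form by (simp add: field_simps)
next
  assume "1 < m"
  then show "num_opt n m = 2"
    using num_opt_eq_num_walks[of n m] num_walks_init_ge2[of n m] assms by simp
qed

end
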